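(* Let $Q\in\mathcal{S}^n$, let $G_Q$ be its convexity graph, and let $\mathfrak{C}$ be the collection of all maximal cliques of $G_Q$. Then $$\ell(Q)\le\min_{C\in\mathfrak{C}}\ell(Q_{CC})\le\min_{C\in\mathfrak{C}}\nu(Q_{CC})=\nu(Q).$$ Furthermore, both inequalities are satisfied as equalities if and only if $Q\in\mathcal{Q}^n$.
   Context: $\mathcal{S}^m$ is the space of real symmetric $m\times m$ matrices, with trace inner product $\langle U,V\rangle=\sum_{i,j}U_{ij}V_{ij}$; $e$ is the all-ones vector, $E=ee^T$; $\Delta_m=\{x\in\mathbb{R}^m: e^Tx=1,\ x\ge 0\}$. $\mathcal{DN}^m$ is the cone of matrices in $\mathcal{S}^m$ that are both positive semidefinite and entrywise nonnegative. For any $m$ and $M\in\mathcal{S}^m$: $\nu(M)=\min\{x^TMx: x\in\Delta_m\}$ and $\ell(M)=\min\{\langle M,X\rangle:\langle E,X\rangle=1,\ X\in\mathcal{DN}^m\}$. $\mathcal{Q}^m=\{M\in\mathcal{S}^m:\ell(M)=\nu(M)\}$. The convexity graph of $Q\in\mathcal{S}^n$ is the simple undirected graph $G_Q=(V_Q,E_Q)$ with $V_Q=\{1,\dots,n\}$ and $E_Q=\{(i,j):1\le i<j\le n,\ 2Q_{ij}<Q_{ii}+Q_{jj}\}$. A clique is a set of mutually adjacent vertices (single vertices are cliques); it is maximal if it is not a proper subset of another clique. $Q_{CC}\in\mathcal{S}^{|C|}$ denotes the principal submatrix of $Q$ with rows and columns indexed by $C$. *)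

theory Defs
  imports "Jordan_Normal_Form.DL_Submatrix" "HOL-Library.Ramsey"
begin

text \<open>
  Matrices are those of Jordan_Normal_Form, so that the order can vary with the
  principal submatrix. Indices therefore run over \<open>0, \<dots>, n - 1\<close> instead of
  \<open>1, \<dots>, n\<close>.
\<close>

definition sym_mats :: "nat \<Rightarrow> real mat set" where
  "sym_mats m = {M \<in> carrier_mat m m. transpose_mat M = M}"

definition trace_inner :: "real mat \<Rightarrow> real mat \<Rightarrow> real" where
  "trace_inner U V = (\<Sum>i<dim_row U. \<Sum>j<dim_col U. U $$ (i, j) * V $$ (i, j))"

definition ones_vec :: "nat \<Rightarrow> real vec" where
  "ones_vec m = vec m (\<lambda>_. 1)"

definition ones_mat :: "nat \<Rightarrow> real mat" where
  "ones_mat m = mat m m (\<lambda>_. 1)"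

definition std_simplex :: "nat \<Rightarrow> real vec set" where
  "std_simplex m = {x \<in> carrier_vec m. ones_vec m \<bullet> x = 1 \<and> (\<forall>i<m. x $ i \<ge> 0)}"

definition pos_semidef :: "real mat \<Rightarrow> bool" where
  "pos_semidef M \<longleftrightarrow> (\<forall>v \<in> carrier_vec (dim_row M). v \<bullet> (M *\<^sub>v v) \<ge> 0)"

definition DN :: "nat \<Rightarrow> real mat set" where
  "DN m = {M \<in> sym_mats m. pos_semidef M \<and> (\<forall>i<m. \<forall>j<m. M $$ (i, j) \<ge> 0)}"

text \<open>
  The minima below are least elements of sets of reals; they are attained for
  \<open>M \<in> sym_mats m\<close> with \<open>m \<ge> 1\<close>, the feasible sets being nonempty and compact.
\<close>

definition nu :: "real mat \<Rightarrow> real" where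
  "nu M = (LEAST v. v \<in> (\<lambda>x. x \<bullet> (M *\<^sub>v x)) ` std_simplex (dim_row M))"

definition ell :: "real mat \<Rightarrow> real" where
  "ell M = (LEAST v. v \<in> trace_inner M `
     {X \<in> DN (dim_row M). trace_inner (ones_mat (dim_row M)) X = 1})"

definition exact_mats :: "nat \<Rightarrow> real mat set" where
  "exact_mats m = {M \<in> sym_mats m. ell M = nu M}"

definition convexity_verts :: "real mat \<Rightarrow> nat set" where
  "convexity_verts Q = {0..<dim_row Q}"

definition convexity_edges :: "real mat \<Rightarrow> nat set set" where
  "convexity_edges Q =
     {{i, j} | i j. i < j \<and> j < dim_row Q \<and> 2 * Q $$ (i, j) < Q $$ (i, i) + Q $$ (j, j)}"

text \<open>
  The library predicate \<open>clique\<close> is also true of the empty set. This is harmless for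
  maximal cliques of a graph with a vertex, as single vertices are cliques.
\<close>

definition cliques :: "nat set \<Rightarrow> nat set set \<Rightarrow> nat set set" where
  "cliques V E = {C. C \<subseteq> V \<and> clique C E}"

definition maximal_cliques :: "nat set \<Rightarrow> nat set set \<Rightarrow> nat set set" where
  "maximal_cliques V E = {C \<in> cliques V E. \<not> (\<exists>D \<in> cliques V E. C \<subset> D)}"

definition convexity_max_cliques :: "real mat \<Rightarrow> nat set set" where
  "convexity_max_cliques Q = maximal_cliques (convexity_verts Q) (convexity_edges Q)"

definition principal_submat :: "real mat \<Rightarrow> nat set \<Rightarrow> real mat" where
  "principal_submat Q C = submatrix Q C C"

end

theory Submission
  imports Defs "HOL-Analysis.Function_Topology"
begin

text \<open>
  The inequalities come from two embeddings. Extending a matrix or a vector by zeros carries the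
  feasible sets of a principal submatrix into those of \<open>Q\<close> without changing the
  objective, so neither minimum of \<open>Q\<close> exceeds that of a principal submatrix
  (\<open>ell_le_ell_principal_submat\<close>, \<open>nu_le_nu_principal_submat\<close>). And
  \<open>x\<close> on the simplex yields the doubly nonnegative matrix \<open>x x\<^sup>T\<close>
  with the same objective, so \<open>ell \<le> nu\<close> (\<open>ell_le_nu\<close>).

  What remains is that some maximal clique \<open>C\<close> loses nothing: the value of
  \<open>nu Q\<close> is attained at a point supported on a clique
  (\<open>nu_attained_on_clique\<close>). Among all minimisers take one, \<open>x\<close>, of smallest
  support. If \<open>i\<close> and \<open>j\<close> were distinct nonadjacent vertices of its support,
  the quadratic form would be concave along the direction \<open>e\<^sub>i - e\<^sub>j\<close>, because
  its second-order coefficient there is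
  \<open>Q\<^sub>i\<^sub>i + Q\<^sub>j\<^sub>j - 2 Q\<^sub>i\<^sub>j \<le> 0\<close>. A concave function with a
  minimum inside a segment is constant on it, so moving all of \<open>x\<^sub>j\<close> to
  \<open>i\<close> would give another minimiser of smaller support.
  The support is therefore a clique, and any maximal clique \<open>C\<close> around it satisfies
  \<open>nu (principal_submat Q C) = nu Q\<close> (\<open>Min_nu_principal_submat\<close>).

  The chain of inequalities thus runs from \<open>ell Q\<close> to \<open>nu Q\<close>, and all its
  members coincide exactly if its two ends do.

  Since \<open>nu\<close> and \<open>ell\<close> are least elements, each argument needs the minima to
  exist. The feasible points have entries in \<open>[0, 1]\<close>, so existence follows from
  Tychonoff's theorem once vectors and matrices are read as functions on indices
  (\<open>nu_attained\<close>, \<open>ell_attained\<close>).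
\<close>

section \<open>Quadratic forms and trace products as double sums\<close>

text \<open>
  The argument is a function rather than a vector of matching dimension, so that composition with
  an index map and the product topology are directly available.
\<close>

definition quad_form :: "real mat \<Rightarrow> (nat \<Rightarrow> real) \<Rightarrow> real" where
  "quad_form M x = (\<Sum>i<dim_row M. \<Sum>j<dim_row M. M $$ (i, j) * (x i * x j))"

lemma scalar_prod_mult_mat_vec:
  assumes "M \<in> carrier_mat m m" "v \<in> carrier_vec m"
  shows "v \<bullet> (M *\<^sub>v v) = quad_form M (($) v)"
  using assms
  by (auto simp: quad_form_def scalar_prod_def sum_distrib_left lessThan_atLeast0 mult_ac
      intro!: sum.cong)

lemma quad_form_cong:
  assumes "\<And>i. i < dim_row M \<Longrightarrow> x i = y i"
  shows "quad_form M x = quad_form M y"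
  unfolding quad_form_def using assms by (intro sum.cong) auto

lemma pos_semidef_iff_quad_form:
  assumes M: "M \<in> carrier_mat m m"
  shows "pos_semidef M \<longleftrightarrow> (\<forall>x. 0 \<le> quad_form M x)"
proof
  assume psd: "pos_semidef M"
  show "\<forall>x. 0 \<le> quad_form M x"
  proof
    fix x
    have "0 \<le> vec m x \<bullet> (M *\<^sub>v vec m x)"
      using psd M unfolding pos_semidef_def by auto
    also have "\<dots> = quad_form M (($) (vec m x))"
      using M by (intro scalar_prod_mult_mat_vec) auto
    also have "\<dots> = quad_form M x"
      using M by (intro quad_form_cong) auto
    finally show "0 \<le> quad_form M x" .
  qed
next
  assume "\<forall>x. 0 \<le> quad_form M x"
  then show "pos_semidef M"
    using M scalar_prod_mult_mat_vec[OF M] unfolding pos_semidef_def by auto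
qed

lemma sym_mats_swap:
  assumes "M \<in> sym_mats m" "i < m" "j < m"
  shows "M $$ (i, j) = M $$ (j, i)"
proof -
  have "M \<in> carrier_mat m m" "transpose_mat M = M"
    using assms(1) by (auto simp: sym_mats_def)
  then show ?thesis
    using assms(2,3) index_transpose_mat(1)[of i M j] by simp
qed

lemma trace_inner_eq:
  assumes "M \<in> carrier_mat m m"
  shows "trace_inner M X = (\<Sum>i<m. \<Sum>j<m. M $$ (i, j) * X $$ (i, j))"
  using assms by (simp add: trace_inner_def)

lemma trace_inner_ones_mat:
  "trace_inner (ones_mat m) X = (\<Sum>i<m. \<Sum>j<m. X $$ (i, j))"
  by (simp add: trace_inner_def ones_mat_def)

text \<open>
  Each condition is a weak inequality or an equation between continuous functions of the entries,
  which is why the cone is closed.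
\<close>

lemma DN_iff:
  "X \<in> DN m \<longleftrightarrow> X \<in> carrier_mat m m \<and> (\<forall>i<m. \<forall>j<m. X $$ (i, j) = X $$ (j, i))
     \<and> (\<forall>x. 0 \<le> quad_form X x) \<and> (\<forall>i<m. \<forall>j<m. 0 \<le> X $$ (i, j))"
proof (cases "X \<in> carrier_mat m m")
  case True
  then have "transpose_mat X = X \<longleftrightarrow> (\<forall>i<m. \<forall>j<m. X $$ (i, j) = X $$ (j, i))"
    using sym_mats_swap[of X m] unfolding sym_mats_def by (auto intro!: eq_matI)
  with True show ?thesis
    using pos_semidef_iff_quad_form[OF True] unfolding DN_def sym_mats_def by auto
next
  case False
  then show ?thesis unfolding DN_def sym_mats_def by auto
qed

section \<open>Attainment of the two minima\<close>

text \<open>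
  This is Tychonoff's theorem. It holds over any index type, so one lemma serves vectors
  (indexed by \<open>nat\<close>) and matrices (indexed by \<open>nat \<times> nat\<close>) of every size.
\<close>

lemma compact_unit_box: "compact {F :: 'a \<Rightarrow> real. \<forall>p. 0 \<le> F p \<and> F p \<le> 1}"
proof -
  have "compactin (product_topology (\<lambda>_. euclidean) UNIV) (PiE UNIV (\<lambda>_::'a. {0..1::real}))"
    unfolding compactin_PiE by (simp add: compact_Icc del: atLeastAtMost_iff)
  moreover have "PiE UNIV (\<lambda>_::'a. {0..1::real}) = {F. \<forall>p. 0 \<le> F p \<and> F p \<le> 1}"
    by auto
  ultimately show ?thesis by (simp add: euclidean_product_topology)
qed

lemma attains_min_in_unit_box:
  fixes f :: "('a \<Rightarrow> real) \<Rightarrow> real"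
  assumes "closed S" "S \<subseteq> {F. \<forall>p. 0 \<le> F p \<and> F p \<le> 1}" "S \<noteq> {}" "continuous_on UNIV f"
  obtains F where "F \<in> S" "\<And>G. G \<in> S \<Longrightarrow> f F \<le> f G"
proof -
  have "S = {F. \<forall>p. 0 \<le> F p \<and> F p \<le> 1} \<inter> S" using assms(2) by blast
  then have "compact S" using compact_Int_closed[OF compact_unit_box assms(1)] by simp
  then show thesis
    using continuous_attains_inf[of S f] assms(3) continuous_on_subset[OF assms(4)] that by blast
qed

lemma Least_image_eq:
  fixes f :: "'a \<Rightarrow> 'b::order"
  assumes "a \<in> S" "\<And>b. b \<in> S \<Longrightarrow> f a \<le> f b"
  shows "(LEAST v. v \<in> f ` S) = f a"
  by (rule Least_equality) (use assms in auto)

definition simplex_coords :: "nat \<Rightarrow> (nat \<Rightarrow> real) set" where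
  "simplex_coords m = {x. (\<forall>i<m. 0 \<le> x i) \<and> (\<Sum>i<m. x i) = 1}"

lemma vec_in_std_simplex_iff: "vec m x \<in> std_simplex m \<longleftrightarrow> x \<in> simplex_coords m"
  by (auto simp: std_simplex_def simplex_coords_def ones_vec_def scalar_prod_def lessThan_atLeast0)

lemma coords_of_std_simplex: "v \<in> std_simplex m \<Longrightarrow> ($) v \<in> simplex_coords m"
  by (auto simp: std_simplex_def simplex_coords_def ones_vec_def scalar_prod_def lessThan_atLeast0)

lemma simplex_coords_le_one:
  assumes "x \<in> simplex_coords m" "i < m"
  shows "x i \<le> 1"
proof -
  have "x i \<le> (\<Sum>i<m. x i)"
    using assms by (intro member_le_sum) (auto simp: simplex_coords_def)
  then show ?thesis using assms by (simp add: simplex_coords_def)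
qed

text \<open>
  The least element defining \<open>nu\<close> exists because the simplex is compact: it is a closed
  subset of the unit box.
\<close>

lemma nu_attained:
  assumes M: "M \<in> carrier_mat m m" and "m \<ge> 1"
  obtains x where "x \<in> simplex_coords m" "nu M = quad_form M x"
    "\<And>y. y \<in> simplex_coords m \<Longrightarrow> nu M \<le> quad_form M y"
proof -
  define S where "S = {x::nat \<Rightarrow> real. (\<forall>p. 0 \<le> x p \<and> x p \<le> 1) \<and> (\<Sum>i<m. x i) = 1}"
  have cl: "closed S"
    unfolding S_def
    by (intro closed_Collect_conj closed_Collect_all closed_Collect_le closed_Collect_eq continuous_intros)
      auto
  have "(\<lambda>i. if i = 0 then 1 else 0) \<in> S"
    using \<open>m \<ge> 1\<close> by (auto simp: S_def)
  then have ne: "S \<noteq> {}" by blast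
  have bd: "S \<subseteq> {x. \<forall>p. 0 \<le> x p \<and> x p \<le> 1}"
    by (auto simp: S_def)
  have cont: "continuous_on UNIV (quad_form M)"
    unfolding quad_form_def by (intro continuous_intros) auto
  obtain x where x: "x \<in> S" "\<And>y. y \<in> S \<Longrightarrow> quad_form M x \<le> quad_form M y"
    using attains_min_in_unit_box[OF cl bd ne cont] by blast
  have min: "quad_form M x \<le> quad_form M y" if y: "y \<in> simplex_coords m" for y
  proof -
    \<comment> \<open>The compact set bounds all coordinates, whereas \<open>y\<close> is free outside \<open>{..<m}\<close>.\<close>
    let ?y = "\<lambda>i. if i < m then y i else 0"
    have "?y \<in> S" using y simplex_coords_le_one[OF y] by (auto simp: S_def simplex_coords_def)
    then have "quad_form M x \<le> quad_form M ?y" by (rule x)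
    also have "\<dots> = quad_form M y" using M by (intro quad_form_cong) auto
    finally show ?thesis .
  qed
  have x': "x \<in> simplex_coords m" using x(1) by (auto simp: S_def simplex_coords_def)
  have qf: "v \<bullet> (M *\<^sub>v v) = quad_form M (($) v)" if "v \<in> std_simplex m" for v
    using M that by (intro scalar_prod_mult_mat_vec) (auto simp: std_simplex_def)
  have vx: "vec m x \<bullet> (M *\<^sub>v vec m x) = quad_form M x"
    using qf[of "vec m x"] x' M quad_form_cong[of M "($) (vec m x)" x]
    by (simp add: vec_in_std_simplex_iff)
  have "nu M = vec m x \<bullet> (M *\<^sub>v vec m x)"
    unfolding nu_def
  proof (rule Least_image_eq)
    show "vec m x \<in> std_simplex (dim_row M)" using M x' by (simp add: vec_in_std_simplex_iff)
    show "vec m x \<bullet> (M *\<^sub>v vec m x) \<le> v \<bullet> (M *\<^sub>v v)" if "v \<in> std_simplex (dim_row M)" for v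
      using that M min[OF coords_of_std_simplex] qf vx by simp
  qed
  with vx min x' that show thesis by simp
qed

text \<open>
  The feasible set is compact because the entries are nonnegative and sum to one, which places
  the closed cone section in the unit box.
\<close>

lemma ell_attained:
  assumes M: "M \<in> carrier_mat m m" and "m \<ge> 1"
  obtains X where "X \<in> DN m" "trace_inner (ones_mat m) X = 1" "ell M = trace_inner M X"
    "\<And>Y. Y \<in> DN m \<Longrightarrow> trace_inner (ones_mat m) Y = 1 \<Longrightarrow> ell M \<le> trace_inner M Y"
proof -
  define S where "S = {F::nat \<times> nat \<Rightarrow> real. (\<forall>p. 0 \<le> F p \<and> F p \<le> 1) \<and>
      (\<forall>i j. F (i, j) = F (j, i)) \<and>
      (\<forall>x::nat \<Rightarrow> real. 0 \<le> (\<Sum>i<m. \<Sum>j<m. F (i, j) * (x i * x j))) \<and>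
      (\<Sum>i<m. \<Sum>j<m. F (i, j)) = 1}"
  define g where "g F = (\<Sum>i<m. \<Sum>j<m. M $$ (i, j) * F (i, j))" for F :: "nat \<times> nat \<Rightarrow> real"
  have cl: "closed S"
    unfolding S_def
    by (intro closed_Collect_conj closed_Collect_all closed_Collect_le closed_Collect_eq continuous_intros)
      auto
  have "(\<lambda>(i, j). (if i = 0 then 1 else 0) * (if j = 0 then 1 else 0)) \<in> S"
    using \<open>m \<ge> 1\<close>
    by (auto simp: S_def if_distrib[where f = "\<lambda>c. c * _"] if_distrib[where f = "\<lambda>c. _ * c"]
        cong: if_cong)
  then have ne: "S \<noteq> {}" by blast
  have bd: "S \<subseteq> {F. \<forall>p. 0 \<le> F p \<and> F p \<le> 1}"
    by (auto simp: S_def)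
  have cont: "continuous_on UNIV g"
    unfolding g_def by (intro continuous_intros) auto
  obtain F where F: "F \<in> S" "\<And>G. G \<in> S \<Longrightarrow> g F \<le> g G"
    using attains_min_in_unit_box[OF cl bd ne cont] by blast
  define X where "X = mat m m F"
  have X: "X \<in> DN m" "trace_inner (ones_mat m) X = 1" "trace_inner M X = g F"
    using F(1) M
    by (simp_all add: DN_iff X_def S_def quad_form_def trace_inner_ones_mat trace_inner_eq g_def)
  have min: "trace_inner M X \<le> trace_inner M Y"
    if Y: "Y \<in> DN m" "trace_inner (ones_mat m) Y = 1" for Y
  proof -
    let ?G = "\<lambda>(i, j). if i < m \<and> j < m then Y $$ (i, j) else 0"
    have nonneg: "0 \<le> Y $$ (i, j)" if "i < m" "j < m" for i j
      using Y(1) that by (simp add: DN_iff)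
    have "Y $$ (i, j) \<le> 1" if "i < m" "j < m" for i j
    proof -
      have "Y $$ (i, j) \<le> (\<Sum>j<m. Y $$ (i, j))"
        using that nonneg by (intro member_le_sum) auto
      also have "\<dots> \<le> (\<Sum>i<m. \<Sum>j<m. Y $$ (i, j))"
        using that nonneg by (intro member_le_sum[of i _ "\<lambda>i. \<Sum>j<m. Y $$ (i, j)"] sum_nonneg) auto
      finally show ?thesis using Y(2) by (simp add: trace_inner_ones_mat)
    qed
    moreover have "0 \<le> (\<Sum>i<m. \<Sum>j<m. Y $$ (i, j) * (x i * x j))" for x
      using Y(1) by (auto simp: DN_iff quad_form_def)
    ultimately have "?G \<in> S"
      using Y nonneg by (auto simp: S_def DN_iff trace_inner_ones_mat)
    then have "g F \<le> g ?G" by (rule F)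
    also have "\<dots> = trace_inner M Y" using M by (simp add: g_def trace_inner_eq)
    finally show ?thesis using X by simp
  qed
  have "ell M = trace_inner M X"
    unfolding ell_def by (rule Least_image_eq) (use M X min in auto)
  with X min that show thesis by simp
qed

lemma nu_le:
  assumes "M \<in> carrier_mat m m" "m \<ge> 1" "x \<in> simplex_coords m"
  shows "nu M \<le> quad_form M x"
  by (rule nu_attained[OF assms(1,2)]) (use assms(3) in blast)

lemma ell_le:
  assumes "M \<in> carrier_mat m m" "m \<ge> 1" "X \<in> DN m" "trace_inner (ones_mat m) X = 1"
  shows "ell M \<le> trace_inner M X"
  by (rule ell_attained[OF assms(1,2)]) (use assms(3,4) in blast)

text \<open>
  A point \<open>x\<close> of the simplex gives the feasible matrix \<open>x x\<^sup>T\<close>,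
  whose quadratic form is a square.
\<close>

lemma ell_le_nu:
  assumes M: "M \<in> carrier_mat m m" and m: "m \<ge> 1"
  shows "ell M \<le> nu M"
proof -
  obtain x where x: "x \<in> simplex_coords m" "nu M = quad_form M x"
    using nu_attained[OF M m] by blast
  define X where "X = mat m m (\<lambda>(i, j). x i * x j)"
  have "0 \<le> quad_form X y" for y
  proof -
    have "quad_form X y = (\<Sum>i<m. x i * y i)\<^sup>2"
      by (auto simp: quad_form_def X_def power2_eq_square sum_product mult_ac intro!: sum.cong)
    then show ?thesis by simp
  qed
  then have "X \<in> DN m"
    using x(1) by (auto simp: DN_iff X_def simplex_coords_def)
  moreover have "trace_inner (ones_mat m) X = 1"
    using x(1) by (simp add: trace_inner_ones_mat X_def simplex_coords_def flip: sum_product)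
  moreover have "trace_inner M X = nu M"
    using M x(2) by (simp add: trace_inner_eq X_def quad_form_def)
  ultimately show ?thesis using ell_le[OF M m, of X] by simp
qed

section \<open>Passing to a principal submatrix\<close>

text \<open>
  On \<open>C\<close> this is the inverse of \<open>pick C\<close>, the increasing enumeration by which
  \<open>submatrix\<close> selects rows and columns.
\<close>

definition rank_in :: "nat set \<Rightarrow> nat \<Rightarrow> nat" where
  "rank_in C a = card {b \<in> C. b < a}"

lemma pick_rank_in: "a \<in> C \<Longrightarrow> pick C (rank_in C a) = a"
  unfolding rank_in_def by (rule pick_card_in_set)

lemma rank_in_less:
  assumes "finite C" "a \<in> C"
  shows "rank_in C a < card C"
  unfolding rank_in_def using assms by (intro psubset_card_mono) auto

lemma bij_betw_rank_in:
  assumes "finite C"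
  shows "bij_betw (rank_in C) C {..<card C}"
proof -
  have inj: "inj_on (rank_in C) C" by (metis inj_onI pick_rank_in)
  moreover have "rank_in C ` C = {..<card C}"
    using assms rank_in_less by (intro card_subset_eq) (auto simp: card_image[OF inj])
  ultimately show ?thesis by (simp add: bij_betw_def)
qed

lemma rank_in_pick:
  assumes "finite C" "i < card C"
  shows "rank_in C (pick C i) = i"
proof -
  obtain a where "a \<in> C" "i = rank_in C a"
    using bij_betw_rank_in[OF assms(1)] assms(2) by (auto simp: bij_betw_def image_iff)
  then show ?thesis by (simp add: pick_rank_in)
qed

lemma pick_in:
  assumes "finite C" "i < card C"
  shows "pick C i \<in> C"
  using bij_betw_rank_in[OF assms(1)] assms(2) pick_rank_in
  by (metis bij_betw_imp_surj_on imageE lessThan_iff)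

text \<open>
  Sums over zero-extended families reduce to sums over the enumeration of \<open>C\<close>; the case
  distinction is exactly the shape that extension by zero produces.
\<close>

lemma sum_pick:
  assumes "C \<subseteq> {..<n}"
  shows "(\<Sum>a<n. if a \<in> C then h a else 0) = (\<Sum>i<card C. h (pick C i) :: real)"
proof -
  have fin: "finite C" using assms finite_subset by blast
  have "(\<Sum>a<n. if a \<in> C then h a else 0) = (\<Sum>a\<in>C. h a)"
    using assms by (simp add: sum.inter_restrict[symmetric] Int_absorb1)
  also have "\<dots> = (\<Sum>a\<in>C. h (pick C (rank_in C a)))"
    by (simp add: pick_rank_in)
  also have "\<dots> = (\<Sum>i<card C. h (pick C i))"
    by (rule sum.reindex_bij_betw[OF bij_betw_rank_in[OF fin]])
  finally show ?thesis .
qed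

lemma sum_pick2:
  assumes "C \<subseteq> {..<n}"
  shows "(\<Sum>a<n. \<Sum>b<n. if a \<in> C \<and> b \<in> C then h a b else 0)
    = (\<Sum>i<card C. \<Sum>j<card C. h (pick C i) (pick C j) :: real)"
proof -
  have "(\<Sum>b<n. if a \<in> C \<and> b \<in> C then h a b else 0)
      = (if a \<in> C then \<Sum>j<card C. h a (pick C j) else 0)" for a
    by (simp add: sum_pick[OF assms])
  then show ?thesis by (simp add: sum_pick[OF assms])
qed

lemma principal_submat_carrier:
  assumes "Q \<in> carrier_mat n n" "C \<subseteq> {..<n}"
  shows "principal_submat Q C \<in> carrier_mat (card C) (card C)"
proof -
  have "{i. i < n \<and> i \<in> C} = C" using assms(2) by auto
  then show ?thesis
    using assms(1) dim_submatrix[of Q C C] by (auto simp: principal_submat_def)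
qed

lemma principal_submat_index:
  assumes "Q \<in> carrier_mat n n" "C \<subseteq> {..<n}" "i < card C" "j < card C"
  shows "principal_submat Q C $$ (i, j) = Q $$ (pick C i, pick C j)"
proof -
  have "{i. i < n \<and> i \<in> C} = C" using assms(2) by auto
  then show ?thesis
    using assms submatrix_index[of i Q C j C] by (simp add: principal_submat_def)
qed

lemma quad_form_supported:
  assumes Q: "Q \<in> carrier_mat n n" and C: "C \<subseteq> {..<n}"
    and supp: "\<And>a. a < n \<Longrightarrow> a \<notin> C \<Longrightarrow> x a = 0"
  shows "quad_form Q x = quad_form (principal_submat Q C) (x \<circ> pick C)"
proof -
  have "quad_form Q x
      = (\<Sum>a<n. \<Sum>b<n. if a \<in> C \<and> b \<in> C then Q $$ (a, b) * (x a * x b) else 0)"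
    using Q supp by (auto simp: quad_form_def intro!: sum.cong)
  then show ?thesis
    using principal_submat_carrier[OF Q C] principal_submat_index[OF Q C]
    by (simp add: sum_pick2[OF C] quad_form_def)
qed

lemma nu_le_nu_principal_submat:
  assumes Q: "Q \<in> carrier_mat n n" and C: "C \<subseteq> {..<n}" "C \<noteq> {}"
  shows "nu Q \<le> nu (principal_submat Q C)"
proof -
  have fin: "finite C" using C finite_subset by blast
  have k: "card C \<ge> 1" using C fin by (simp add: Suc_leI card_gt_0_iff)
  have n: "n \<ge> 1" using C by (cases n) auto
  let ?P = "principal_submat Q C"
  have P: "?P \<in> carrier_mat (card C) (card C)" by (rule principal_submat_carrier[OF Q C(1)])
  obtain y where y: "y \<in> simplex_coords (card C)" "nu ?P = quad_form ?P y"
    using nu_attained[OF P k] by blast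
  define x where "x a = (if a \<in> C then y (rank_in C a) else 0)" for a
  have xy: "x (pick C i) = y i" if "i < card C" for i
    using that fin by (simp add: x_def pick_in rank_in_pick)
  have "x \<in> simplex_coords n"
    using y(1) rank_in_less[OF fin] xy
    by (auto simp: simplex_coords_def x_def sum_pick[OF C(1)] rank_in_pick[OF fin])
  then have "nu Q \<le> quad_form Q x" by (rule nu_le[OF Q n])
  also have "\<dots> = quad_form ?P (x \<circ> pick C)"
    by (rule quad_form_supported[OF Q C(1)]) (simp add: x_def)
  also have "\<dots> = quad_form ?P y"
    using P xy by (intro quad_form_cong) auto
  finally show ?thesis using y by simp
qed

text \<open>
  The converse of zero extension: a feasible point that already vanishes off \<open>C\<close>
  restricts to a feasible point for the principal submatrix.
\<close>

lemma nu_principal_submat_le: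
  assumes Q: "Q \<in> carrier_mat n n" and C: "C \<subseteq> {..<n}"
    and x: "x \<in> simplex_coords n" and supp: "\<And>a. a < n \<Longrightarrow> a \<notin> C \<Longrightarrow> x a = 0"
  shows "nu (principal_submat Q C) \<le> quad_form Q x"
proof -
  have fin: "finite C" using C finite_subset by blast
  have "(\<Sum>a<n. x a) = (\<Sum>a<n. if a \<in> C then x a else 0)"
    using supp by (intro sum.cong) auto
  then have sum1: "(\<Sum>i<card C. x (pick C i)) = 1"
    using x by (simp add: simplex_coords_def sum_pick[OF C])
  then have k: "card C \<ge> 1" by (cases "card C") auto
  have "x \<circ> pick C \<in> simplex_coords (card C)"
    using sum1 x pick_in[OF fin] C by (auto simp: simplex_coords_def)
  then have "nu (principal_submat Q C) \<le> quad_form (principal_submat Q C) (x \<circ> pick C)"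
    by (rule nu_le[OF principal_submat_carrier[OF Q C] k])
  also have "\<dots> = quad_form Q x"
    by (rule quad_form_supported[OF Q C supp, symmetric])
  finally show ?thesis .
qed

text \<open>
  Zero extension preserves positive semidefiniteness because the form of the extended matrix at
  \<open>v\<close> is the form of the original one at the restriction of \<open>v\<close>.
\<close>

lemma ell_le_ell_principal_submat:
  assumes Q: "Q \<in> carrier_mat n n" and C: "C \<subseteq> {..<n}" "C \<noteq> {}"
  shows "ell Q \<le> ell (principal_submat Q C)"
proof -
  have fin: "finite C" using C finite_subset by blast
  have k: "card C \<ge> 1" using C fin by (simp add: Suc_leI card_gt_0_iff)
  have n: "n \<ge> 1" using C by (cases n) auto
  let ?P = "principal_submat Q C"
  have P: "?P \<in> carrier_mat (card C) (card C)" by (rule principal_submat_carrier[OF Q C(1)])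
  obtain X where X: "X \<in> DN (card C)" "trace_inner (ones_mat (card C)) X = 1"
      "ell ?P = trace_inner ?P X"
    using ell_attained[OF P k] by blast
  define Y where
    "Y = mat n n (\<lambda>(a, b). if a \<in> C \<and> b \<in> C then X $$ (rank_in C a, rank_in C b) else 0)"
  have Ysum: "(\<Sum>a<n. \<Sum>b<n. h a b * Y $$ (a, b))
      = (\<Sum>i<card C. \<Sum>j<card C. h (pick C i) (pick C j) * X $$ (i, j))" for h
  proof -
    have "(\<Sum>a<n. \<Sum>b<n. h a b * Y $$ (a, b)) = (\<Sum>a<n. \<Sum>b<n.
        if a \<in> C \<and> b \<in> C then h a b * X $$ (rank_in C a, rank_in C b) else 0)"
      by (auto simp: Y_def intro!: sum.cong)
    then show ?thesis by (simp add: sum_pick2[OF C(1)] rank_in_pick[OF fin])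
  qed
  have dims: "dim_row X = card C" "dim_row Y = n"
    using X(1) by (auto simp: DN_iff Y_def)
  have "quad_form Y v = quad_form X (v \<circ> pick C)" for v
    using Ysum[of "\<lambda>a b. v a * v b"] dims by (simp add: quad_form_def mult.commute)
  then have "Y \<in> DN n"
    using X(1) rank_in_less[OF fin] by (auto simp: DN_iff Y_def)
  moreover have "trace_inner (ones_mat n) Y = 1"
    using Ysum[of "\<lambda>_ _. 1"] X(2) by (simp add: trace_inner_ones_mat)
  ultimately have "ell Q \<le> trace_inner Q Y" by (rule ell_le[OF Q n])
  also have "\<dots> = trace_inner ?P X"
    using Ysum[of "\<lambda>a b. Q $$ (a, b)"] principal_submat_index[OF Q C(1)]
    by (simp add: trace_inner_eq[OF Q] trace_inner_eq[OF P])
  finally show ?thesis using X(3) by simp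
qed

section \<open>A minimiser supported on a clique\<close>

lemma sum_transfer:
  fixes h :: "nat \<Rightarrow> real"
  assumes "i < n" "j < n"
  shows "(\<Sum>b<n. h b * (of_bool (b = i) - of_bool (b = j))) = h i - h j"
proof -
  have "h b * (of_bool (b = i) - of_bool (b = j))
      = (if b = i then h b else 0) - (if b = j then h b else 0)" for b
    by simp
  then show ?thesis using assms by (simp only: sum_subtractf) simp
qed

text \<open>
  Along a transfer of weight from \<open>j\<close> to \<open>i\<close> the form is a quadratic polynomial
  in the amount \<open>t\<close>. Its linear coefficient is left unspecified, since optimality
  determines it wherever it is needed.
\<close>

lemma quad_form_transfer:
  fixes x :: "nat \<Rightarrow> real"
  assumes Q: "Q \<in> sym_mats n" and ij: "i < n" "j < n"
  shows "\<exists>L. \<forall>t. quad_form Q (\<lambda>a. x a + t * (of_bool (a = i) - of_bool (a = j)))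
    = quad_form Q x + t * L + t\<^sup>2 * (Q $$ (i, i) + Q $$ (j, j) - 2 * Q $$ (i, j))"
proof -
  have dim: "dim_row Q = n" using Q by (auto simp: sym_mats_def)
  let ?d = "\<lambda>a. of_bool (a = i) - of_bool (a = j) :: real"
  define L where "L = (\<Sum>a<n. \<Sum>b<n. Q $$ (a, b) * (x a * ?d b + ?d a * x b))"
  have "quad_form Q (\<lambda>a. x a + t * ?d a) = quad_form Q x + t * L + t\<^sup>2 * quad_form Q ?d" for t
    by (simp add: quad_form_def dim L_def sum_distrib_left sum.distrib[symmetric]
        algebra_simps power2_eq_square)
  moreover have "quad_form Q ?d = Q $$ (i, i) + Q $$ (j, j) - 2 * Q $$ (i, j)"
  proof -
    have "quad_form Q ?d = (\<Sum>a<n. (\<Sum>b<n. Q $$ (a, b) * ?d b) * ?d a)"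
      unfolding quad_form_def dim sum_distrib_right
      by (intro sum.cong refl) (simp only: mult_ac)
    then show ?thesis
      using sum_transfer[OF ij] sym_mats_swap[OF Q ij] by simp
  qed
  ultimately show ?thesis by auto
qed

text \<open>
  Edges are listed with their smaller endpoint first; by symmetry of \<open>Q\<close> the order is
  immaterial.
\<close>

lemma convexity_edge_iff:
  assumes Q: "Q \<in> sym_mats n" and "i < n" "j < n" "i \<noteq> j"
  shows "{i, j} \<in> convexity_edges Q \<longleftrightarrow> 2 * Q $$ (i, j) < Q $$ (i, i) + Q $$ (j, j)"
proof -
  have "dim_row Q = n" using Q by (auto simp: sym_mats_def)
  then show ?thesis
    using assms sym_mats_swap[OF Q, of i j] unfolding convexity_edges_def
    by (auto simp: doubleton_eq_iff) (metis add.commute linorder_neqE_nat)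
qed

text \<open>
  The clique is the support of a minimiser of smallest support: between two nonadjacent vertices
  weight could be transferred at no cost until one of them leaves the support.
\<close>

lemma nu_attained_on_clique:
  assumes Q: "Q \<in> sym_mats n" and n: "n \<ge> 1"
  obtains x where "x \<in> simplex_coords n" "quad_form Q x = nu Q"
    "clique {a. a < n \<and> x a \<noteq> 0} (convexity_edges Q)"
proof -
  have Qc: "Q \<in> carrier_mat n n" using Q by (simp add: sym_mats_def)
  let ?supp = "\<lambda>x::nat \<Rightarrow> real. {a. a < n \<and> x a \<noteq> 0}"
  let ?opt = "\<lambda>x. x \<in> simplex_coords n \<and> quad_form Q x = nu Q"
  obtain x0 where "x0 \<in> simplex_coords n" "nu Q = quad_form Q x0"
    using nu_attained[OF Qc n] by blast
  then have "?opt x0" by simp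
  then obtain x where x: "?opt x" and least: "\<And>y. ?opt y \<Longrightarrow> card (?supp x) \<le> card (?supp y)"
    using ex_has_least_nat[of ?opt x0 "\<lambda>x. card (?supp x)"] by blast
  have "{i, j} \<in> convexity_edges Q" if i: "i \<in> ?supp x" and j: "j \<in> ?supp x" and "i \<noteq> j" for i j
  proof (rule ccontr)
    assume "{i, j} \<notin> convexity_edges Q"
    define c where "c = Q $$ (i, i) + Q $$ (j, j) - 2 * Q $$ (i, j)"
    have c: "c \<le> 0"
      using \<open>{i, j} \<notin> _\<close> convexity_edge_iff[OF Q] i j \<open>i \<noteq> j\<close> by (auto simp: c_def)
    define y where "y t a = x a + t * (of_bool (a = i) - of_bool (a = j))" for t a
    obtain L where L: "\<And>t. quad_form Q (y t) = nu Q + t * L + t\<^sup>2 * c"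
      using quad_form_transfer[OF Q, of i j x] i j x unfolding y_def c_def by auto
    have pos: "x i > 0" "x j > 0"
      using i j x by (auto simp: simplex_coords_def order_less_le)
    have feas: "y t \<in> simplex_coords n" if "- x i \<le> t" "t \<le> x j" for t
    proof -
      have "(\<Sum>a<n. y t a) = (\<Sum>a<n. x a)"
        using i j sum_transfer[of i n j "\<lambda>_. t"] by (simp add: y_def sum.distrib)
      then show ?thesis using that x \<open>i \<noteq> j\<close> by (auto simp: simplex_coords_def y_def)
    qed
    \<comment> \<open>Minimality at both ends of the feasible segment bounds the slope \<open>L\<close> from both sides
      by multiples of \<open>c\<close>, and \<open>c \<le> 0\<close> then forces both to vanish.\<close>
    have "0 \<le> t * L + t\<^sup>2 * c" if "- x i \<le> t" "t \<le> x j" for t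
      using nu_le[OF Qc n feas[OF that]] L[of t] by simp
    from this[of "- x i"] this[of "x j"] pos
    have "0 \<le> x i * (- L + x i * c)" "0 \<le> x j * (L + x j * c)"
      by (simp_all add: algebra_simps power2_eq_square)
    then have "0 \<le> - L + x i * c" "0 \<le> L + x j * c"
      using pos by (simp_all add: zero_le_mult_iff)
    moreover have "x i * c \<le> 0" "x j * c \<le> 0"
      using pos c by (simp_all add: mult_nonneg_nonpos)
    ultimately have "L = 0" "x j * c = 0" by linarith+
    then have "quad_form Q (y (x j)) = nu Q" by (simp add: L power2_eq_square)
    then have "card (?supp x) \<le> card (?supp (y (x j)))"
      using feas[of "x j"] pos by (intro least) auto
    moreover have "?supp (y (x j)) \<subset> ?supp x"
    proof -
      have "j \<notin> ?supp (y (x j))" using \<open>i \<noteq> j\<close> by (simp add: y_def)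
      moreover have "?supp (y (x j)) \<subseteq> ?supp x" using i by (auto simp: y_def)
      ultimately show ?thesis using j by blast
    qed
    ultimately show False
      using psubset_card_mono[of "?supp x" "?supp (y (x j))"] by simp
  qed
  then have "clique (?supp x) (convexity_edges Q)" by (auto simp: clique_def)
  with x that show thesis by blast
qed

section \<open>Minimising over the maximal cliques\<close>

lemma convexity_max_cliques_subset:
  "Q \<in> carrier_mat n n \<Longrightarrow> C \<in> convexity_max_cliques Q \<Longrightarrow> C \<subseteq> {..<n}"
  by (auto simp: convexity_max_cliques_def maximal_cliques_def cliques_def convexity_verts_def)

lemma finite_convexity_max_cliques: "Q \<in> carrier_mat n n \<Longrightarrow> finite (convexity_max_cliques Q)"
  by (rule finite_subset[of _ "Pow {..<n}"]) (auto dest: convexity_max_cliques_subset)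

lemma clique_extends_to_max_clique:
  assumes Q: "Q \<in> carrier_mat n n" and S: "S \<subseteq> {..<n}" "clique S (convexity_edges Q)"
  obtains C where "C \<in> convexity_max_cliques Q" "S \<subseteq> C"
proof -
  let ?K = "cliques (convexity_verts Q) (convexity_edges Q)"
  have "finite ?K" by (auto simp: cliques_def convexity_verts_def)
  moreover have "S \<in> ?K" using Q S by (auto simp: cliques_def convexity_verts_def)
  ultimately obtain C where "C \<in> ?K" "S \<subseteq> C" "\<forall>D\<in>?K. C \<subseteq> D \<longrightarrow> C = D"
    using finite_has_maximal2[of ?K S] by metis
  then show thesis
    using that[of C] by (auto simp: convexity_max_cliques_def maximal_cliques_def)
qed

text \<open>
  The empty set is a clique, but a vertex exists and forms a larger one.
\<close>

lemma convexity_max_cliques_nonempty: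
  assumes Q: "Q \<in> carrier_mat n n" and "n \<ge> 1" "C \<in> convexity_max_cliques Q"
  shows "C \<noteq> {}"
proof
  assume "C = {}"
  moreover have "{0} \<in> cliques (convexity_verts Q) (convexity_edges Q)"
    using Q \<open>n \<ge> 1\<close> by (auto simp: cliques_def convexity_verts_def clique_def)
  ultimately show False
    using assms(3) by (auto simp: convexity_max_cliques_def maximal_cliques_def)
qed

lemma Min_nu_principal_submat:
  assumes Q: "Q \<in> sym_mats n" and n: "n \<ge> 1"
  shows "(MIN C\<in>convexity_max_cliques Q. nu (principal_submat Q C)) = nu Q"
proof -
  have Qc: "Q \<in> carrier_mat n n" using Q by (simp add: sym_mats_def)
  obtain x where x: "x \<in> simplex_coords n" "quad_form Q x = nu Q"
      "clique {a. a < n \<and> x a \<noteq> 0} (convexity_edges Q)"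
    using nu_attained_on_clique[OF Q n] by blast
  obtain C where C: "C \<in> convexity_max_cliques Q" "{a. a < n \<and> x a \<noteq> 0} \<subseteq> C"
    using clique_extends_to_max_clique[OF Qc _ x(3)] by auto
  have sub: "nu Q \<le> nu (principal_submat Q D)" if "D \<in> convexity_max_cliques Q" for D
    by (rule nu_le_nu_principal_submat[OF Qc convexity_max_cliques_subset[OF Qc that]
          convexity_max_cliques_nonempty[OF Qc n that]])
  have "nu (principal_submat Q C) \<le> quad_form Q x"
    using nu_principal_submat_le[OF Qc convexity_max_cliques_subset[OF Qc C(1)] x(1)] C(2) by blast
  with sub[OF C(1)] x(2) have "nu (principal_submat Q C) = nu Q" by simp
  then show ?thesis
    using C(1) sub finite_convexity_max_cliques[OF Qc]
    by (intro Min_eqI) (auto intro: rev_image_eqI)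
qed

theorem lemma5p1:
  fixes n :: nat and Q :: "real mat"
  assumes "n \<ge> 1" and "Q \<in> sym_mats n"
  shows "ell Q \<le> (MIN C\<in>convexity_max_cliques Q. ell (principal_submat Q C))
    \<and> (MIN C\<in>convexity_max_cliques Q. ell (principal_submat Q C))
        \<le> (MIN C\<in>convexity_max_cliques Q. nu (principal_submat Q C))
    \<and> (MIN C\<in>convexity_max_cliques Q. nu (principal_submat Q C)) = nu Q
    \<and> ((ell Q = (MIN C\<in>convexity_max_cliques Q. ell (principal_submat Q C))
         \<and> (MIN C\<in>convexity_max_cliques Q. ell (principal_submat Q C))
             = (MIN C\<in>convexity_max_cliques Q. nu (principal_submat Q C)))
       \<longleftrightarrow> Q \<in> exact_mats n)"
proof -
  let ?K = "convexity_max_cliques Q"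
  let ?l = "\<lambda>C. ell (principal_submat Q C)" and ?v = "\<lambda>C. nu (principal_submat Q C)"
  have Qc: "Q \<in> carrier_mat n n" using assms by (simp add: sym_mats_def)
  have fin: "finite ?K" by (rule finite_convexity_max_cliques[OF Qc])
  have ne: "?K \<noteq> {}"
    using clique_extends_to_max_clique[OF Qc, of "{}"] by (auto simp: clique_def)
  have l: "ell Q \<le> ?l C" if "C \<in> ?K" for C
    by (rule ell_le_ell_principal_submat[OF Qc convexity_max_cliques_subset[OF Qc that]
          convexity_max_cliques_nonempty[OF Qc assms(1) that]])
  have lv: "?l C \<le> ?v C" if "C \<in> ?K" for C
  proof -
    have "C \<subseteq> {..<n}" "C \<noteq> {}"
      by (rule convexity_max_cliques_subset[OF Qc that])
        (rule convexity_max_cliques_nonempty[OF Qc assms(1) that])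
    then show ?thesis
      using ell_le_nu[OF principal_submat_carrier[OF Qc]] finite_subset[of C "{..<n}"]
      by (simp add: Suc_leI card_gt_0_iff)
  qed
  have "ell Q \<le> Min (?l ` ?K)" using fin ne l by simp
  moreover have "Min (?l ` ?K) \<le> Min (?v ` ?K)"
  proof -
    have "Min (?l ` ?K) \<le> ?v C" if "C \<in> ?K" for C
      using Min_le[OF finite_imageI[OF fin] imageI[OF that]] lv[OF that] by (rule order_trans)
    then show ?thesis using fin ne by simp
  qed
  moreover have "Min (?v ` ?K) = nu Q" by (rule Min_nu_principal_submat[OF assms(2,1)])
  ultimately show ?thesis using assms(2) unfolding exact_mats_def by auto
qed

end
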